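(* Let $A\subseteq\{1,\dots,n\}$ and $i,j\in\{1,\dots,n\}\setminus A$ with $i\ne j$. Then in $Q_n$ $$\big(r(A\cup\{i,j\})-r(A\cup\{i\})\big)\big(r(A\cup\{i\})-r(A\cup\{j\})\big)=\big(r(A\cup\{i\})-r(A\cup\{j\})\big)\big(r(A\cup\{j\})-r(A)\big)$$ and $$[z_{A,i},z_{A,j}]=\sum_{\{i,j\}\subseteq D\subseteq A\cup\{i,j\}}u(D)\,(z_{A,i}-z_{A,j}).$$
   Context: Let $k$ be a field and $n\ge 1$. $Q_n$ is the associative unital $k$-algebra with generators $z_{A,i}$, for $A\subseteq\{1,\dots,n\}$ and $i\in\{1,\dots,n\}\setminus A$, and defining relations $$z_{A\cup\{i\},j}+z_{A,i}=z_{A\cup\{j\},i}+z_{A,j},\qquad z_{A\cup\{i\},j}\,z_{A,i}=z_{A\cup\{j\},i}\,z_{A,j}$$ for all $A$ and all distinct $i,j\notin A$. $T_n\subseteq Q_n$ is the $k$-linear span of all $z_{A,i}$, and $\bar T_n=T_n\oplus k\cdot1$. $K_n=k[v_1,\dots,v_n]/(v_i^2+v_i:1\le i\le n)$, and $w_i$ is the image of $v_i$. There is an algebra homomorphism $\phi:Q_n\to K_n$ with $\phi(z_{A,i})=w_i\prod_{j\in A}(1+w_j)$, and its restriction $\phi|_{\bar T_n}:\bar T_n\to K_n$ is an isomorphism of vector spaces. For $A,B\subseteq\{1,\dots,n\}$, $z_{A,B}$ is the projection to $T_n$ (along $k\cdot 1$) of $(\phi|_{\bar T_n})^{-1}\big(\prod_{i\in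 B}w_i\prod_{j\in A}(1+w_j)\big)$. Put $r(A)=z_{A,\emptyset}$ and $u(B)=z_{\emptyset,B}$. Here $[a,b]=ab-ba$. *)

theory Defs
  imports Complex_Main "HOL-Library.Poly_Mapping"
begin

text \<open>
  The index set \<open>{1,\<dots>,n}\<close> is rendered as a type \<open>'n\<close> of class \<^class>\<open>finite\<close>, so that
  \<open>n = CARD('n)\<close> is an arbitrary positive integer. Quantifying over \<open>'n\<close> is quantifying over
  \<open>n \<ge> 1\<close>; the order on the indices plays no role. The ground field is the type \<open>'k\<close>.
\<close>

section \<open>Two-sided ideals\<close>

inductive_set ideal_gen :: "'a::ring_1 set \<Rightarrow> 'a set" for S where
  ideal_base: "x \<in> S \<Longrightarrow> x \<in> ideal_gen S"
| ideal_zero: "0 \<in> ideal_gen S"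
| ideal_add: "x \<in> ideal_gen S \<Longrightarrow> y \<in> ideal_gen S \<Longrightarrow> x + y \<in> ideal_gen S"
| ideal_lmult: "x \<in> ideal_gen S \<Longrightarrow> a * x \<in> ideal_gen S"
| ideal_rmult: "x \<in> ideal_gen S \<Longrightarrow> x * a \<in> ideal_gen S"

lemma ideal_uminus: "x \<in> ideal_gen S \<Longrightarrow> - x \<in> ideal_gen S"
  using ideal_lmult[of x S "-1"] by simp

lemma ideal_diff: "x \<in> ideal_gen S \<Longrightarrow> y \<in> ideal_gen S \<Longrightarrow> x - y \<in> ideal_gen S"
  using ideal_add[of x S "-y"] ideal_uminus[of y S] by simp

lemma equivp_ideal_gen: "equivp (\<lambda>p q. p - q \<in> ideal_gen S)"
proof (rule equivpI)
  show "reflp (\<lambda>p q. p - q \<in> ideal_gen S)"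
    by (rule reflpI) (simp add: ideal_zero)
  show "symp (\<lambda>p q. p - q \<in> ideal_gen S)"
    by (rule sympI) (metis ideal_uminus minus_diff_eq)
  show "transp (\<lambda>p q. p - q \<in> ideal_gen S)"
  proof (rule transpI)
    fix x y z assume "x - y \<in> ideal_gen S" "y - z \<in> ideal_gen S"
    from ideal_add[OF this] show "x - z \<in> ideal_gen S" by simp
  qed
qed

lemma ideal_cong_add:
  "p - p' \<in> ideal_gen S \<Longrightarrow> q - q' \<in> ideal_gen S \<Longrightarrow> (p + q) - (p' + q') \<in> ideal_gen S"
  using ideal_add[of "p - p'" S "q - q'"] by (simp add: algebra_simps)

lemma ideal_cong_diff:
  "p - p' \<in> ideal_gen S \<Longrightarrow> q - q' \<in> ideal_gen S \<Longrightarrow> (p - q) - (p' - q') \<in> ideal_gen S"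
  using ideal_diff[of "p - p'" S "q - q'"] by (simp add: algebra_simps)

lemma ideal_cong_uminus:
  "p - p' \<in> ideal_gen S \<Longrightarrow> (- p) - (- p') \<in> ideal_gen S"
  using ideal_uminus[of "p - p'" S] by (simp add: algebra_simps)

lemma ideal_cong_mult:
  assumes "p - p' \<in> ideal_gen S" "q - q' \<in> ideal_gen S"
  shows "p * q - p' * q' \<in> ideal_gen S"
proof -
  have "(p - p') * q + p' * (q - q') \<in> ideal_gen S"
    by (intro ideal_add ideal_lmult ideal_rmult assms)
  then show ?thesis by (simp add: algebra_simps)
qed

lemma ideal_gen_hom_zero:
  fixes f :: "'a::ring_1 \<Rightarrow> 'b::ring_1"
  assumes "x \<in> ideal_gen S"
    and "\<And>a b. f (a + b) = f a + f b" "\<And>a b. f (a * b) = f a * f b" "\<And>s. s \<in> S \<Longrightarrow> f s = 0"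
  shows "f x = 0"
  using assms(1)
proof induction
  case ideal_zero
  show ?case using assms(2)[of 0 0] by simp
qed (simp_all add: assms)

section \<open>Evaluation of monoid algebras\<close>

text \<open>For a multiplicative \<open>h\<close>, this is the homomorphism from the monoid algebra \<open>k[m]\<close> extending \<open>h\<close>,
  with \<open>s\<close> the scalar multiplication of the target.\<close>

definition ma_eval :: "('k::zero \<Rightarrow> 'b \<Rightarrow> 'b) \<Rightarrow> ('m \<Rightarrow> 'b) \<Rightarrow> ('m \<Rightarrow>\<^sub>0 'k) \<Rightarrow> 'b::comm_monoid_add" where
  "ma_eval s h p = (\<Sum>m \<in> Poly_Mapping.keys p. s (Poly_Mapping.lookup p m) (h m))"

locale ma_hom = module s
  for s :: "'k::comm_ring_1 \<Rightarrow> 'b::ring_1 \<Rightarrow> 'b" +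
  fixes h :: "'m::monoid_add \<Rightarrow> 'b"
  assumes s_mult: "s (c * d) (x * y) = s c x * s d y"
    and h_zero: "h 0 = 1"
    and h_add: "h (a + b) = h a * h b"
begin

lemma eval_superset:
  assumes "finite X" "Poly_Mapping.keys p \<subseteq> X"
  shows "ma_eval s h p = (\<Sum>m \<in> X. s (Poly_Mapping.lookup p m) (h m))"
  unfolding ma_eval_def
  by (rule sum.mono_neutral_left) (use assms in \<open>auto simp: in_keys_iff\<close>)

lemma eval_add: "ma_eval s h (p + q) = ma_eval s h p + ma_eval s h q"
proof -
  let ?X = "Poly_Mapping.keys p \<union> Poly_Mapping.keys q"
  have "Poly_Mapping.keys (p + q) \<subseteq> ?X" by (rule keys_add)
  then show ?thesis
    by (simp add: eval_superset[of ?X] lookup_add scale_left_distrib sum.distrib)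
qed

lemma eval_single: "ma_eval s h (Poly_Mapping.single m c) = s c (h m)"
  by (subst eval_superset[of "{m}"]) (auto simp: lookup_single)

lemma eval_zero: "ma_eval s h 0 = 0"
  by (simp add: ma_eval_def)

lemma eval_one: "ma_eval s h 1 = 1"
  by (metis eval_single h_zero scale_one single_one)

lemma eval_uminus: "ma_eval s h (- p) = - ma_eval s h p"
  by (metis add.inverse_unique add.right_inverse eval_add eval_zero)

lemma eval_diff: "ma_eval s h (p - q) = ma_eval s h p - ma_eval s h q"
  by (metis eval_add eval_uminus diff_conv_add_uminus)

lemma ma_induct [case_names single add]:
  fixes p :: "'m \<Rightarrow>\<^sub>0 'k"
  assumes "\<And>m c. P (Poly_Mapping.single m c)" "\<And>p q. P p \<Longrightarrow> P q \<Longrightarrow> P (p + q)"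
  shows "P p"
proof (induction p rule: update_induct)
  case const
  then show ?case using assms(1)[of 0 0] by simp
next
  case (update f a b)
  have "Poly_Mapping.update a b f = f + Poly_Mapping.single a b"
    using update by (intro poly_mapping_eqI) (auto simp: lookup_update lookup_add lookup_single in_keys_iff when_def)
  then show ?case using assms update by simp
qed

lemma eval_mult: "ma_eval s h (p * q) = ma_eval s h p * ma_eval s h q"
proof (induction p rule: ma_induct)
  case (single m c)
  show ?case
  proof (induction q rule: ma_induct)
    case (single m' c')
    then show ?case by (simp add: mult_single eval_single h_add s_mult)
  next
    case (add p q)
    then show ?case by (simp add: eval_add distrib_left)
  qed
next
  case (add p q)
  then show ?case by (simp add: eval_add distrib_right)
qed

end

lemma const_coeff_mult:
  fixes p q :: "'m::monoid_add \<Rightarrow>\<^sub>0 'k::comm_ring_1"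
  assumes "\<And>a b :: 'm. a + b = 0 \<longleftrightarrow> a = 0 \<and> b = 0"
  shows "Poly_Mapping.lookup (p * q) 0 = Poly_Mapping.lookup p 0 * Poly_Mapping.lookup q 0"
proof -
  interpret ma_hom "(*)" "\<lambda>m::'m. if m = 0 then 1 else (0::'k)"
    by unfold_locales (auto simp: assms algebra_simps)
  have "ma_eval (*) (\<lambda>m::'m. if m = 0 then 1 else (0::'k)) r = Poly_Mapping.lookup r 0" for r
    by (subst eval_superset[of "insert 0 (Poly_Mapping.keys r)"])
       (auto simp: if_distrib[of "\<lambda>x. _ * x"] sum.delta cong: if_cong)
  with eval_mult show ?thesis by metis
qed

section \<open>Free algebras\<close>

text \<open>\<open>'a word \<Rightarrow>\<^sub>0 'k\<close> is the free associative unital \<open>'k\<close>-algebra on the set of generators \<open>'a\<close>: the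
  algebra of the free monoid, which is written additively as \<^theory>\<open>HOL-Library.Poly_Mapping\<close> requires.\<close>

datatype 'a word = Word (letters: "'a list")

instantiation word :: (type) monoid_add
begin
definition zero_word :: "'a word" where "0 = Word []"
definition plus_word :: "'a word \<Rightarrow> 'a word \<Rightarrow> 'a word" where "x + y = Word (letters x @ letters y)"
instance by standard (auto simp: zero_word_def plus_word_def)
end

lemma word_add_eq_0: "(x::'a word) + y = 0 \<longleftrightarrow> x = 0 \<and> y = 0"
  by (cases x; cases y) (auto simp: zero_word_def plus_word_def)

section \<open>The algebra \<open>Q\<^sub>n\<close>\<close>

text \<open>The generators: pairs \<open>(A, i)\<close> with \<open>i \<notin> A\<close>.\<close>

typedef 'n zgen = "{(A :: 'n set, i :: 'n). i \<notin> A}"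
  by auto

definition zfree :: "'n set \<Rightarrow> 'n \<Rightarrow> ('n zgen word \<Rightarrow>\<^sub>0 'k::field)" where
  "zfree A i = Poly_Mapping.single (Word [Abs_zgen (A, i)]) 1"

definition Qrels :: "('n zgen word \<Rightarrow>\<^sub>0 'k::field) set" where
  "Qrels =
     {(zfree (A \<union> {i}) j + zfree A i) - (zfree (A \<union> {j}) i + zfree A j) | A i j.
        i \<notin> A \<and> j \<notin> A \<and> i \<noteq> j} \<union>
     {zfree (A \<union> {i}) j * zfree A i - zfree (A \<union> {j}) i * zfree A j | A i j.
        i \<notin> A \<and> j \<notin> A \<and> i \<noteq> j}"

lemma const_coeff_zfree: "Poly_Mapping.lookup (zfree A i) 0 = 0"
  by (simp add: zfree_def lookup_single zero_word_def)

lemma one_notin_Qideal: "(1 :: 'n zgen word \<Rightarrow>\<^sub>0 'k::field) \<notin> ideal_gen Qrels"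
proof
  assume *: "(1 :: 'n zgen word \<Rightarrow>\<^sub>0 'k::field) \<in> ideal_gen Qrels"
  have "Poly_Mapping.lookup (1 :: 'n zgen word \<Rightarrow>\<^sub>0 'k::field) 0 = 0"
    by (rule ideal_gen_hom_zero[OF *, of "\<lambda>p. Poly_Mapping.lookup p 0"])
       (auto simp: const_coeff_mult word_add_eq_0 lookup_add lookup_minus const_coeff_zfree Qrels_def)
  then show False by simp
qed

quotient_type (overloaded) ('n, 'k) Qalg =
  "('n::finite) zgen word \<Rightarrow>\<^sub>0 'k::field" / "\<lambda>p q. p - q \<in> ideal_gen Qrels"
  by (rule equivp_ideal_gen)

instantiation Qalg :: (finite, field) ring_1
begin
lift_definition zero_Qalg :: "('a, 'b) Qalg" is 0 .
lift_definition one_Qalg :: "('a, 'b) Qalg" is 1 .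
lift_definition plus_Qalg :: "('a, 'b) Qalg \<Rightarrow> ('a, 'b) Qalg \<Rightarrow> ('a, 'b) Qalg" is "(+)"
  by (rule ideal_cong_add)
lift_definition minus_Qalg :: "('a, 'b) Qalg \<Rightarrow> ('a, 'b) Qalg \<Rightarrow> ('a, 'b) Qalg" is "(-)"
  by (rule ideal_cong_diff)
lift_definition uminus_Qalg :: "('a, 'b) Qalg \<Rightarrow> ('a, 'b) Qalg" is uminus
  by (rule ideal_cong_uminus)
lift_definition times_Qalg :: "('a, 'b) Qalg \<Rightarrow> ('a, 'b) Qalg \<Rightarrow> ('a, 'b) Qalg" is "(*)"
  by (rule ideal_cong_mult)
instance
proof
  show "(0 :: ('a, 'b) Qalg) \<noteq> 1"
  proof transfer
    show "(0 :: 'a zgen word \<Rightarrow>\<^sub>0 'b) - 1 \<notin> ideal_gen Qrels"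
    proof
      assume "(0 :: 'a zgen word \<Rightarrow>\<^sub>0 'b) - 1 \<in> ideal_gen Qrels"
      from ideal_uminus[OF this] show False by (simp add: one_notin_Qideal)
    qed
  qed
next
  fix x y z :: "('a, 'b) Qalg"
  show "x * y * z = x * (y * z)" by transfer (simp add: mult.assoc ideal_zero)
  show "(x + y) * z = x * z + y * z" by transfer (simp add: distrib_right ideal_zero)
  show "x * (y + z) = x * y + x * z" by transfer (simp add: distrib_left ideal_zero)
  show "1 * x = x" by transfer (simp add: ideal_zero)
  show "x * 1 = x" by transfer (simp add: ideal_zero)
  show "x + y + z = x + (y + z)" by transfer (simp add: add.assoc ideal_zero)
  show "x + y = y + x" by transfer (simp add: add.commute ideal_zero)
  show "0 + x = x" by transfer (simp add: ideal_zero)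
  show "- x + x = 0" by transfer (simp add: ideal_zero)
  show "x - y = x + - y" by transfer (simp add: ideal_zero)
qed
end

lift_definition scaleQ :: "'k \<Rightarrow> ('n::finite, 'k::field) Qalg \<Rightarrow> ('n, 'k) Qalg"
  is "\<lambda>c p. Poly_Mapping.single 0 c * p"
  by (rule ideal_cong_mult) (auto simp: ideal_zero)

lemma vector_space_scaleQ: "vector_space scaleQ"
proof
  fix a b :: "'k::field" and x y :: "('n::finite, 'k::field) Qalg"
  show "scaleQ a (x + y) = scaleQ a x + scaleQ a y"
    by transfer (simp add: algebra_simps ideal_zero)
  show "scaleQ (a + b) x = scaleQ a x + scaleQ b x"
    by transfer (simp add: algebra_simps ideal_zero single_add)
  show "scaleQ a (scaleQ b x) = scaleQ (a * b) x"
    by transfer (simp add: mult_single ideal_zero flip: mult.assoc)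
  show "scaleQ 1 x = x"
    by transfer (simp add: ideal_zero)
qed

text \<open>\<open>z A i\<close> is meaningful only for \<open>i \<notin> A\<close>; otherwise \<^const>\<open>Abs_zgen\<close> yields an unspecified generator.\<close>

lift_definition z :: "'n set \<Rightarrow> 'n \<Rightarrow> ('n::finite, 'k::field) Qalg" is zfree .

lemma zfree_rels:
  assumes "i \<notin> A" "j \<notin> A" "i \<noteq> j"
  shows "(zfree (A \<union> {i}) j + zfree A i) - (zfree (A \<union> {j}) i + zfree A j) \<in> Qrels"
    and "zfree (A \<union> {i}) j * zfree A i - zfree (A \<union> {j}) i * zfree A j \<in> Qrels"
  unfolding Qrels_def
   apply (rule UnI1, rule CollectI, intro exI conjI, rule refl, rule assms, rule assms, rule assms)
  apply (rule UnI2, rule CollectI, intro exI conjI, rule refl, rule assms, rule assms, rule assms)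
  done

lemma z_rel_add:
  assumes "i \<notin> A" "j \<notin> A" "i \<noteq> j"
  shows "z (A \<union> {i}) j + z A i = z (A \<union> {j}) i + z A j"
  by (simp only: z_def map_fun_apply id_apply plus_Qalg.abs_eq Qalg.abs_eq_iff)
     (rule ideal_base, rule zfree_rels(1)[OF assms])

lemma z_rel_mult:
  assumes "i \<notin> A" "j \<notin> A" "i \<noteq> j"
  shows "z (A \<union> {i}) j * z A i = z (A \<union> {j}) i * z A j"
  by (simp only: z_def map_fun_apply id_apply times_Qalg.abs_eq Qalg.abs_eq_iff)
     (rule ideal_base, rule zfree_rels(2)[OF assms])

definition T :: "('n::finite, 'k::field) Qalg set" where
  "T = module.span scaleQ {z A i | A i. i \<notin> A}"

definition Tbar :: "('n::finite, 'k::field) Qalg set" where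
  "Tbar = {t + scaleQ c 1 | t c. t \<in> T}"

text \<open>Projection along \<open>k\<cdot>1\<close>, for arguments in \<^const>\<open>Tbar\<close>; the description is unique because \<open>1 \<notin> T\<close>.\<close>

definition projT :: "('n::finite, 'k::field) Qalg \<Rightarrow> ('n, 'k) Qalg" where
  "projT x = (THE t. t \<in> T \<and> (\<exists>c. x = t + scaleQ c 1))"

section \<open>The algebra \<open>K\<^sub>n\<close>\<close>

text \<open>\<open>('n \<Rightarrow>\<^sub>0 nat) \<Rightarrow>\<^sub>0 'k\<close> is the commutative polynomial ring over \<open>'k\<close> in variables indexed by \<open>'n\<close>.\<close>

definition var :: "'n \<Rightarrow> (('n \<Rightarrow>\<^sub>0 nat) \<Rightarrow>\<^sub>0 'k::field)" where
  "var i = Poly_Mapping.single (Poly_Mapping.single i 1) 1"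

definition Krels :: "(('n \<Rightarrow>\<^sub>0 nat) \<Rightarrow>\<^sub>0 'k::field) set" where
  "Krels = {(var i)^2 + var i | i. True}"

lemma monom_add_eq_0: "(x :: 'n \<Rightarrow>\<^sub>0 nat) + y = 0 \<longleftrightarrow> x = 0 \<and> y = 0"
  by (auto simp: poly_mapping_eq_iff lookup_add fun_eq_iff)

lemma const_coeff_var: "Poly_Mapping.lookup (var i) 0 = 0"
proof -
  have "Poly_Mapping.single i (1::nat) \<noteq> 0"
    by (metis lookup_single_eq lookup_zero zero_neq_one)
  then show ?thesis by (simp add: var_def lookup_single when_def)
qed

lemma one_notin_Kideal: "(1 :: ('n \<Rightarrow>\<^sub>0 nat) \<Rightarrow>\<^sub>0 'k::field) \<notin> ideal_gen Krels"
proof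
  assume *: "(1 :: ('n \<Rightarrow>\<^sub>0 nat) \<Rightarrow>\<^sub>0 'k::field) \<in> ideal_gen Krels"
  have "Poly_Mapping.lookup (1 :: ('n \<Rightarrow>\<^sub>0 nat) \<Rightarrow>\<^sub>0 'k::field) 0 = 0"
    by (rule ideal_gen_hom_zero[OF *, of "\<lambda>p. Poly_Mapping.lookup p 0"])
       (auto simp: const_coeff_mult monom_add_eq_0 lookup_add const_coeff_var Krels_def power2_eq_square)
  then show False by simp
qed

quotient_type (overloaded) ('n, 'k) Kalg =
  "(('n::finite) \<Rightarrow>\<^sub>0 nat) \<Rightarrow>\<^sub>0 'k::field" / "\<lambda>p q. p - q \<in> ideal_gen Krels"
  by (rule equivp_ideal_gen)

instantiation Kalg :: (finite, field) comm_ring_1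
begin
lift_definition zero_Kalg :: "('a, 'b) Kalg" is 0 .
lift_definition one_Kalg :: "('a, 'b) Kalg" is 1 .
lift_definition plus_Kalg :: "('a, 'b) Kalg \<Rightarrow> ('a, 'b) Kalg \<Rightarrow> ('a, 'b) Kalg" is "(+)"
  by (rule ideal_cong_add)
lift_definition minus_Kalg :: "('a, 'b) Kalg \<Rightarrow> ('a, 'b) Kalg \<Rightarrow> ('a, 'b) Kalg" is "(-)"
  by (rule ideal_cong_diff)
lift_definition uminus_Kalg :: "('a, 'b) Kalg \<Rightarrow> ('a, 'b) Kalg" is uminus
  by (rule ideal_cong_uminus)
lift_definition times_Kalg :: "('a, 'b) Kalg \<Rightarrow> ('a, 'b) Kalg \<Rightarrow> ('a, 'b) Kalg" is "(*)"
  by (rule ideal_cong_mult)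
instance
proof
  show "(0 :: ('a, 'b) Kalg) \<noteq> 1"
  proof transfer
    show "(0 :: ('a \<Rightarrow>\<^sub>0 nat) \<Rightarrow>\<^sub>0 'b) - 1 \<notin> ideal_gen Krels"
    proof
      assume "(0 :: ('a \<Rightarrow>\<^sub>0 nat) \<Rightarrow>\<^sub>0 'b) - 1 \<in> ideal_gen Krels"
      from ideal_uminus[OF this] show False by (simp add: one_notin_Kideal)
    qed
  qed
next
  fix x y z :: "('a, 'b) Kalg"
  show "x * y * z = x * (y * z)" by transfer (simp add: mult.assoc ideal_zero)
  show "x * y = y * x" by transfer (simp add: mult.commute ideal_zero)
  show "(x + y) * z = x * z + y * z" by transfer (simp add: distrib_right ideal_zero)
  show "1 * x = x" by transfer (simp add: ideal_zero)
  show "x + y + z = x + (y + z)" by transfer (simp add: add.assoc ideal_zero)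
  show "x + y = y + x" by transfer (simp add: add.commute ideal_zero)
  show "0 + x = x" by transfer (simp add: ideal_zero)
  show "- x + x = 0" by transfer (simp add: ideal_zero)
  show "x - y = x + - y" by transfer (simp add: ideal_zero)
qed
end

lift_definition scaleK :: "'k \<Rightarrow> ('n::finite, 'k::field) Kalg \<Rightarrow> ('n, 'k) Kalg"
  is "\<lambda>c p. Poly_Mapping.single 0 c * p"
  by (rule ideal_cong_mult) (auto simp: ideal_zero)

lemma vector_space_scaleK: "vector_space scaleK"
proof
  fix a b :: "'k::field" and x y :: "('n::finite, 'k::field) Kalg"
  show "scaleK a (x + y) = scaleK a x + scaleK a y"
    by transfer (simp add: algebra_simps ideal_zero)
  show "scaleK (a + b) x = scaleK a x + scaleK b x"
    by transfer (simp add: algebra_simps ideal_zero single_add)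
  show "scaleK a (scaleK b x) = scaleK (a * b) x"
    by transfer (simp add: mult_single ideal_zero flip: mult.assoc)
  show "scaleK 1 x = x"
    by transfer (simp add: ideal_zero)
qed

lemma scaleK_mult: "scaleK (c * d) (x * y) = scaleK c x * scaleK d y"
proof transfer
  fix c d :: 'b and x y :: "('a \<Rightarrow>\<^sub>0 nat) \<Rightarrow>\<^sub>0 'b"
  have "Poly_Mapping.single 0 (c * d) * (x * y)
      = Poly_Mapping.single 0 c * x * (Poly_Mapping.single 0 d * y)"
    using mult_single[of "0 :: 'a \<Rightarrow>\<^sub>0 nat" c 0 d] by (simp add: ac_simps)
  then show "Poly_Mapping.single 0 (c * d) * (x * y)
      - Poly_Mapping.single 0 c * x * (Poly_Mapping.single 0 d * y) \<in> ideal_gen Krels"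
    by (simp add: ideal_zero)
qed

lift_definition w :: "'n \<Rightarrow> ('n::finite, 'k::field) Kalg" is var .

lemma w_rel: "(w i)^2 + w i = 0"
  unfolding power2_eq_square
  by transfer (auto intro!: ideal_base simp: Krels_def power2_eq_square)

section \<open>The homomorphism \<open>\<phi>\<close> and the elements \<open>z\<^sub>A\<^sub>,\<^sub>B\<close>\<close>

definition phi_gen :: "'n zgen \<Rightarrow> ('n::finite, 'k::field) Kalg" where
  "phi_gen g = (case Rep_zgen g of (A, i) \<Rightarrow> w i * (\<Prod>j\<in>A. 1 + w j))"

definition phi_word :: "'n zgen word \<Rightarrow> ('n::finite, 'k::field) Kalg" where
  "phi_word m = prod_list (map phi_gen (letters m))"

interpretation phi_free: ma_hom scaleK phi_word
proof -
  interpret vector_space "scaleK :: 'k \<Rightarrow> ('n::finite, 'k::field) Kalg \<Rightarrow> _"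
    by (rule vector_space_scaleK)
  show "ma_hom (scaleK :: 'k \<Rightarrow> ('n, 'k) Kalg \<Rightarrow> _) phi_word"
    by unfold_locales (auto simp: scaleK_mult phi_word_def zero_word_def plus_word_def)
qed

lemma phi_free_zfree:
  "i \<notin> A \<Longrightarrow> ma_eval scaleK phi_word (zfree A i) = w i * (\<Prod>j\<in>A. 1 + w j)"
  by (simp add: zfree_def phi_free.eval_single phi_word_def phi_gen_def Abs_zgen_inverse)

lemma phi_free_Qrels:
  assumes "p \<in> Qrels"
  shows "ma_eval scaleK phi_word p = (0 :: ('n::finite, 'k::field) Kalg)"
proof -
  have w2: "w i * w i = - (w i :: ('n, 'k) Kalg)" for i
    using w_rel[of i] by (simp add: power2_eq_square eq_neg_iff_add_eq_0)
  have [simp]: "(w i * (1 + w i)) = (0 :: ('n, 'k) Kalg)" for i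
    by (simp add: distrib_left w2)
  have zero: "w j * ((1 + w i) * x) * (w i * x) = (0 :: ('n, 'k) Kalg)" for i j x
    using arg_cong[of "w i * (1 + w i)" 0 "\<lambda>y. y * (w j * x * x)"] by (simp add: ac_simps)
  show ?thesis
    using assms unfolding Qrels_def
    by (auto simp: phi_free.eval_diff phi_free.eval_add phi_free.eval_mult phi_free_zfree zero)
       (simp add: algebra_simps)
qed

lift_definition phi :: "('n::finite, 'k::field) Qalg \<Rightarrow> ('n, 'k) Kalg"
  is "ma_eval scaleK phi_word"
proof -
  fix p q :: "'n zgen word \<Rightarrow>\<^sub>0 'k"
  assume "p - q \<in> ideal_gen Qrels"
  then have "ma_eval scaleK phi_word (p - q) = (0 :: ('n, 'k) Kalg)"
    by (rule ideal_gen_hom_zero) (simp_all add: phi_free.eval_add phi_free.eval_mult phi_free_Qrels)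
  then show "ma_eval scaleK phi_word p = (ma_eval scaleK phi_word q :: ('n, 'k) Kalg)"
    by (simp add: phi_free.eval_diff)
qed

lemma phi_z: "i \<notin> A \<Longrightarrow> phi (z A i) = w i * (\<Prod>j\<in>A. 1 + w j)"
  by (simp add: z_def phi.abs_eq phi_free_zfree)

lemma phi_add: "phi (x + y) = phi x + phi y"
  by transfer (rule phi_free.eval_add)

lemma phi_mult: "phi (x * y) = phi x * phi y"
  by transfer (rule phi_free.eval_mult)

lemma phi_one: "phi 1 = 1"
  by transfer (rule phi_free.eval_one)

lemma scaleK_one_mult: "scaleK c 1 * x = scaleK c x"
  using scaleK_mult[of c 1 1 x] vector_space.vector_space_assms(4)[OF vector_space_scaleK]
  by (metis mult.right_neutral mult_1)

lemma phi_scale: "phi (scaleQ c x) = scaleK c (phi x)"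
proof (induction x rule: Qalg.abs_induct)
  case (1 p)
  then show ?case
    by (simp only: scaleQ.abs_eq phi.abs_eq phi_free.eval_mult phi_free.eval_single phi_free.h_zero
        scaleK_one_mult)
qed

text \<open>\<^const>\<open>inv_into\<close> is the inverse of the bijective restriction of \<^const>\<open>phi\<close> to \<^const>\<open>Tbar\<close>.\<close>

definition zset :: "'n set \<Rightarrow> 'n set \<Rightarrow> ('n::finite, 'k::field) Qalg" where
  "zset A B = projT (inv_into Tbar phi ((\<Prod>i\<in>B. w i) * (\<Prod>j\<in>A. 1 + w j)))"

definition r :: "'n set \<Rightarrow> ('n::finite, 'k::field) Qalg" where
  "r A = zset A {}"

definition u :: "'n set \<Rightarrow> ('n::finite, 'k::field) Qalg" where
  "u B = zset {} B"

definition commutator :: "'a::ring \<Rightarrow> 'a \<Rightarrow> 'a" where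
  "commutator a b = a * b - b * a"

end

theory Submission
  imports Defs
begin

text \<open>
  Everything is a question about \<open>T\<^sub>n\<close>, because \<^const>\<open>phi\<close> sees an element of \<open>T\<^sub>n\<close> even when its
  value is only known up to an additive constant (\<open>T_eqI\<close>). Thus linear identities between the
  \<open>z\<^sub>A\<^sub>,\<^sub>B\<close> can be read off in the commutative algebra \<open>K\<^sub>n\<close>: the identity
  \<open>\<Prod>\<^sub>A\<^sub>\<union>\<^sub>i (1 + w) - \<Prod>\<^sub>A (1 + w) = w\<^sub>i \<Prod>\<^sub>A (1 + w)\<close> gives \<open>r(A \<union> {i}) - r(A) = z\<^sub>A\<^sub>,\<^sub>i\<close>
  (\<open>r_insert_diff\<close>), and expanding \<open>w\<^sub>i w\<^sub>j \<Prod>\<^sub>A (1 + w)\<close> into monomials gives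
  \<open>\<Sum>\<^sub>D u(D) = z\<^sub>A\<^sub>\<union>\<^sub>i\<^sub>,\<^sub>j - z\<^sub>A\<^sub>,\<^sub>j\<close> (\<open>sum_u_between\<close>).

  After these translations, the first claim becomes
  \<open>z\<^sub>A\<^sub>\<union>\<^sub>i\<^sub>,\<^sub>j (z\<^sub>A\<^sub>,\<^sub>i - z\<^sub>A\<^sub>,\<^sub>j) = (z\<^sub>A\<^sub>,\<^sub>i - z\<^sub>A\<^sub>,\<^sub>j) z\<^sub>A\<^sub>,\<^sub>j\<close>, which is a two-line consequence of the defining
  relations (\<open>z_diff_intertwine\<close>), and the second claim follows by subtracting
  \<open>z\<^sub>A\<^sub>,\<^sub>j (z\<^sub>A\<^sub>,\<^sub>i - z\<^sub>A\<^sub>,\<^sub>j)\<close> from both sides.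

  The work is in the injectivity of \<^const>\<open>phi\<close> on \<^const>\<open>Tbar\<close>. The additive relations say that
  \<open>(A, i) \<mapsto> z\<^sub>A\<^sub>,\<^sub>i\<close>, seen as a function on the edges \<open>A \<rightarrow> A \<union> {i}\<close> of the Boolean lattice, has the
  same sum along both sides of each square, so it is the difference of a potential \<open>E\<close> on the
  vertices. Normalised by \<open>E(\<emptyset>) = 1\<close>, the \<open>2\<^sup>n\<close> elements \<open>E(A)\<close> span \<^const>\<open>Tbar\<close>, and \<^const>\<open>phi\<close>
  sends them to the products \<open>\<Prod>\<^sub>A (1 + w)\<close>, which are linearly independent.
\<close>

interpretation Q: vector_space "scaleQ :: 'k::field \<Rightarrow> ('n::finite, 'k) Qalg \<Rightarrow> _"
  by (rule vector_space_scaleQ)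

section \<open>Points of \<open>K\<^sub>n\<close> and independence of the products of the \<open>1 + w\<^sub>j\<close>\<close>

text \<open>
  The equation \<open>v\<^sup>2 + v = 0\<close> has the roots \<open>0\<close> and \<open>-1\<close>, so a subset \<open>S\<close> determines the character of
  \<open>K\<^sub>n\<close> that sends \<open>w\<^sub>i\<close> to \<open>-1\<close> for \<open>i \<in> S\<close> and to \<open>0\<close> otherwise.
\<close>

definition point_monom :: "'n set \<Rightarrow> ('n::finite \<Rightarrow>\<^sub>0 nat) \<Rightarrow> 'k::field" where
  "point_monom S m = (\<Prod>i\<in>UNIV. (if i \<in> S then - 1 else 0) ^ Poly_Mapping.lookup m i)"

interpretation point: ma_hom "(*)" "point_monom S" for S
  by unfold_locales (simp_all add: point_monom_def algebra_simps lookup_add power_add prod.distrib)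

lemma point_var: "ma_eval (*) (point_monom S) (var i) = (if i \<in> S then - 1 else 0)"
proof -
  have "(\<Prod>j\<in>UNIV. (if j \<in> S then - 1 else 0 :: 'k::field)
      ^ Poly_Mapping.lookup (Poly_Mapping.single i 1) j) =
    (\<Prod>j\<in>UNIV. if j = i then (if j \<in> S then - 1 else 0) else 1)"
    by (rule prod.cong) (auto simp: lookup_single when_def)
  then show ?thesis
    by (simp add: var_def point.eval_single point_monom_def)
qed

lift_definition evalK :: "'n set \<Rightarrow> ('n::finite, 'k::field) Kalg \<Rightarrow> 'k"
  is "\<lambda>S. ma_eval (*) (point_monom S)"
proof -
  fix S :: "'n set" and p q :: "('n \<Rightarrow>\<^sub>0 nat) \<Rightarrow>\<^sub>0 'k"
  assume "p - q \<in> ideal_gen Krels"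
  then have "ma_eval (*) (point_monom S) (p - q) = 0"
    by (rule ideal_gen_hom_zero)
       (auto simp: point.eval_add point.eval_mult Krels_def point_var power2_eq_square)
  then show "ma_eval (*) (point_monom S) p = ma_eval (*) (point_monom S) q"
    by (simp add: point.eval_diff)
qed

lemma evalK_add: "evalK S (x + y) = evalK S x + evalK S y"
  by transfer (rule point.eval_add)

lemma evalK_mult: "evalK S (x * y) = evalK S x * evalK S y"
  by transfer (rule point.eval_mult)

lemma evalK_one: "evalK S 1 = 1"
  by transfer (rule point.eval_one)

lemma evalK_w: "evalK S (w i) = (if i \<in> S then - 1 else 0)"
  by transfer (rule point_var)

lemma evalK_scale: "evalK S (scaleK c x) = c * evalK S x"
proof (induction x rule: Kalg.abs_induct)
  case (1 p)
  show ?case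
    by (simp only: scaleK.abs_eq evalK.abs_eq point.eval_mult point.eval_single point.h_zero
        mult_1_right)
qed

lemma evalK_zero: "evalK S 0 = 0"
  using evalK_scale[of S 0 0] by simp

lemma evalK_sum: "evalK S (sum f X) = (\<Sum>x\<in>X. evalK S (f x))"
  by (induction X rule: infinite_finite_induct) (simp_all add: evalK_zero evalK_add)

lemma evalK_prod_one_plus_w:
  "evalK S (\<Prod>j\<in>A. 1 + w j) = (if A \<inter> S = {} then 1 else 0)"
proof -
  have "finite A" by simp
  then show ?thesis
    by (induction A) (auto simp: evalK_one evalK_mult evalK_add evalK_w)
qed

text \<open>
  The matrix of the values of \<open>\<Prod>\<^sub>B (1 + w)\<close> at the points \<open>S = - A\<close> is triangular with respect to
  inclusion: the value is \<open>1\<close> if \<open>B \<subseteq> A\<close> and \<open>0\<close> otherwise.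
\<close>

lemma prods_one_plus_w_independent:
  fixes c :: "'n::finite set \<Rightarrow> 'k::field"
  assumes "(\<Sum>A\<in>UNIV. scaleK (c A) (\<Prod>j\<in>A. 1 + w j)) = (0 :: ('n, 'k) Kalg)"
  shows "c A = 0"
proof -
  have "finite A" by simp
  then show ?thesis
  proof (induction A rule: finite_psubset_induct)
    case (psubset A)
    \<comment> \<open>Only subsets of \<open>A\<close> survive at the point \<open>- A\<close>, and the coefficients of the proper ones vanish by induction.\<close>
    have "0 = evalK (- A) (\<Sum>B\<in>UNIV. scaleK (c B) (\<Prod>j\<in>B. 1 + w j))"
      by (simp add: assms evalK_zero)
    also have "\<dots> = (\<Sum>B\<in>UNIV. c B * (if B \<inter> - A = {} then 1 else 0))"
      by (simp only: evalK_sum evalK_scale evalK_prod_one_plus_w)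
    also have "\<dots> = (\<Sum>B\<in>{A}. c B * (if B \<inter> - A = {} then 1 else 0))"
      by (rule sum.mono_neutral_right) (use psubset.IH in auto)
    finally show ?case by simp
  qed
qed

section \<open>Injectivity of \<open>\<phi>\<close>\<close>

text \<open>
  A discrete Poincare lemma on the cube. A potential on the subsets of \<open>U\<close> extends to those of
  \<open>U \<union> {x}\<close> by crossing each edge in direction \<open>x\<close> once; closedness of the squares containing \<open>x\<close>
  makes the extension compatible with the other directions.
\<close>

lemma closed_form_has_potential:
  fixes f :: "'n::finite set \<Rightarrow> 'n \<Rightarrow> 'a::ab_group_add"
  assumes closed: "\<And>A i j. i \<notin> A \<Longrightarrow> j \<notin> A \<Longrightarrow> i \<noteq> j \<Longrightarrow>
    f (insert i A) j + f A i = f (insert j A) i + f A j"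
  obtains E where "E {} = a" "\<And>A i. i \<notin> A \<Longrightarrow> E (insert i A) = E A + f A i"
proof -
  have "\<exists>E. E {} = a \<and> (\<forall>A i. A \<subseteq> U \<longrightarrow> i \<in> U \<longrightarrow> i \<notin> A \<longrightarrow> E (insert i A) = E A + f A i)"
    if "finite U" for U :: "'n set"
    using that
  proof induction
    case empty
    show ?case by (intro exI[of _ "\<lambda>_. a"]) simp
  next
    case (insert x U)
    then obtain E where E: "E {} = a"
      "\<And>A i. A \<subseteq> U \<Longrightarrow> i \<in> U \<Longrightarrow> i \<notin> A \<Longrightarrow> E (insert i A) = E A + f A i" by blast
    define E' where "E' A = (if x \<in> A then E (A - {x}) + f (A - {x}) x else E A)" for A
    have "E' (insert i A) = E' A + f A i"
      if A: "A \<subseteq> insert x U" and i: "i \<in> insert x U" "i \<notin> A" for A i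
    proof (cases "x \<in> A")
      case True
      define B where "B = A - {x}"
      have B: "A = insert x B" "x \<notin> B" "B \<subseteq> U" "i \<notin> B" "i \<in> U" "i \<noteq> x"
        using True A i by (auto simp: B_def)
      have "E' (insert i A) = E (insert i B) + f (insert i B) x"
        using B by (auto simp: E'_def insert_commute insert_Diff_if)
      also have "\<dots> = E B + (f (insert i B) x + f B i)"
        using B E(2)[of B i] by (simp add: algebra_simps)
      also have "\<dots> = E B + (f (insert x B) i + f B x)"
        using B closed[of i B x] by simp
      also have "\<dots> = E' A + f A i"
        using B by (simp add: E'_def algebra_simps)
      finally show ?thesis .
    next
      case False
      then show ?thesis
        using A i E(2)[of A i] by (cases "i = x") (auto simp: E'_def)
    qed
    moreover have "E' {} = a" by (simp add: E'_def E(1))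
    ultimately show ?case by blast
  qed
  from this[of UNIV] that show ?thesis by auto
qed

lemma phi_zero: "phi 0 = 0"
  using phi_scale[of 0 0] by simp

lemma phi_diff: "phi (x - y) = phi x - phi y"
  using phi_add[of "x - y" y] by (simp add: algebra_simps)

lemma phi_sum: "phi (sum f X) = (\<Sum>x\<in>X. phi (f x))"
  by (induction X rule: infinite_finite_induct) (simp_all add: phi_zero phi_add)

lemma phi_potential:
  fixes E :: "'n::finite set \<Rightarrow> ('n, 'k::field) Qalg"
  assumes "E {} = 1" "\<And>A i. i \<notin> A \<Longrightarrow> E (insert i A) = E A + z A i"
  shows "phi (E A) = (\<Prod>j\<in>A. 1 + w j)"
proof -
  have "finite A" by simp
  then show ?thesis
    by (induction A) (simp_all add: assms phi_one phi_add phi_z algebra_simps)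
qed

lemma z_in_T: "i \<notin> A \<Longrightarrow> z A i \<in> T"
  unfolding T_def by (rule Q.span_base) blast

lemma subspace_T: "Q.subspace T"
  unfolding T_def by (rule Q.subspace_span)

lemma Tbar_eq_span:
  "(Tbar :: ('n::finite, 'k::field) Qalg set) = Q.span (insert 1 {z A i | A i. i \<notin> A})"
proof -
  have "x = t + scaleQ c 1 \<longleftrightarrow> x - scaleQ c 1 = t" for x t :: "('n, 'k) Qalg" and c
    by (auto simp: algebra_simps)
  then show ?thesis
    unfolding Tbar_def T_def Q.span_insert by auto
qed

text \<open>
  For \<open>n \<ge> 2\<close> the \<open>z\<^sub>A\<^sub>,\<^sub>i\<close> are linearly dependent; the potential replaces them by a spanning
  family of \<^const>\<open>Tbar\<close>, indexed by subsets, whose images under \<^const>\<open>phi\<close> are independent.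
\<close>

lemma obtain_potential:
  obtains E :: "'n::finite set \<Rightarrow> ('n, 'k::field) Qalg"
  where "\<And>A. phi (E A) = (\<Prod>j\<in>A. 1 + w j)" "Tbar = Q.span (range E)"
proof -
  obtain E :: "'n set \<Rightarrow> ('n, 'k) Qalg"
    where E: "E {} = 1" "\<And>A i. i \<notin> A \<Longrightarrow> E (insert i A) = E A + z A i"
    by (rule closed_form_has_potential[of z 1]) (use z_rel_add in auto)
  have "Tbar = Q.span (range E)"
  proof
    have "z A i \<in> Q.span (range E)" if "i \<notin> A" for A i
    proof -
      have "z A i = E (insert i A) - E A" using E(2)[OF that] by simp
      then show ?thesis by (simp add: Q.span_diff Q.span_base)
    qed
    moreover have "1 \<in> Q.span (range E)" by (metis E(1) Q.span_base rangeI)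
    ultimately show "Tbar \<subseteq> Q.span (range E)"
      unfolding Tbar_eq_span by (intro Q.span_minimal) auto
    have "E A \<in> Tbar" for A
    proof -
      have "finite A" by simp
      then show ?thesis unfolding Tbar_eq_span
      proof induction
        case (insert i A)
        have "(z A i :: ('n, 'k) Qalg) \<in> Q.span (insert 1 {z A i | A i. i \<notin> A})"
          using insert.hyps by (intro Q.span_base) blast
        with insert show ?case by (simp add: E(2) Q.span_add)
      qed (simp add: E(1) Q.span_base)
    qed
    then show "Q.span (range E) \<subseteq> Tbar"
      unfolding Tbar_eq_span by (intro Q.span_minimal) auto
  qed
  with phi_potential[OF E] show ?thesis by (rule that)
qed

lemma phi_eq_0_on_Tbar:
  assumes "x \<in> Tbar" "phi x = 0"
  shows "x = (0 :: ('n::finite, 'k::field) Qalg)"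
proof -
  obtain E :: "'n set \<Rightarrow> ('n, 'k) Qalg"
    where E: "\<And>A. phi (E A) = (\<Prod>j\<in>A. 1 + w j)" "Tbar = Q.span (range E)"
    by (rule obtain_potential) (rule that)
  let ?comb = "\<lambda>c. \<Sum>A\<in>UNIV. scaleQ (c A) (E A)"
  have "Q.subspace (range ?comb)"
  proof (rule Q.subspaceI)
    show "0 \<in> range ?comb" by (rule image_eqI[of _ _ "\<lambda>_. 0"]) simp_all
    show "x + y \<in> range ?comb" if "x \<in> range ?comb" "y \<in> range ?comb" for x y
    proof -
      from that obtain c d where "x = ?comb c" "y = ?comb d" by blast
      then have "x + y = ?comb (\<lambda>A. c A + d A)"
        by (simp add: Q.scale_left_distrib sum.distrib)
      then show ?thesis by (rule range_eqI[where x = "\<lambda>A. c A + d A"])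
    qed
    show "scaleQ a x \<in> range ?comb" if "x \<in> range ?comb" for a x
    proof -
      from that obtain c where "x = ?comb c" by blast
      then have "scaleQ a x = ?comb (\<lambda>A. a * c A)"
        by (simp add: Q.scale_sum_right)
      then show ?thesis by (rule range_eqI[where x = "\<lambda>A. a * c A"])
    qed
  qed
  moreover have "E A \<in> range ?comb" for A
  proof -
    have "E A = ?comb (\<lambda>B. if B = A then 1 else 0)"
      by (simp add: if_distrib[of "\<lambda>a. scaleQ a _"] cong: if_cong)
    then show ?thesis by (rule range_eqI[where x = "\<lambda>B. if B = A then 1 else 0"])
  qed
  ultimately have "Q.span (range E) \<subseteq> range ?comb"
    by (intro Q.span_minimal) auto
  with assms(1) E(2) obtain c where c: "x = ?comb c" by blast
  have "(\<Sum>A\<in>UNIV. scaleK (c A) (\<Prod>j\<in>A. 1 + w j)) = phi x"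
    by (simp add: c phi_sum phi_scale E(1))
  with assms(2) have "c A = 0" for A
    by (intro prods_one_plus_w_independent) simp
  then show ?thesis by (simp add: c)
qed

lemma inj_on_phi_Tbar: "inj_on phi Tbar"
proof (rule inj_onI)
  fix x y :: "('n::finite, 'k::field) Qalg"
  assume xy: "x \<in> Tbar" "y \<in> Tbar" "phi x = phi y"
  then have "x - y \<in> Tbar" unfolding Tbar_eq_span by (intro Q.span_diff)
  then show "x = y" using phi_eq_0_on_Tbar[of "x - y"] xy by (simp add: phi_diff)
qed

section \<open>Elements of \<open>T\<^sub>n\<close> are determined by \<open>\<phi>\<close> up to constants\<close>

lemma evalK_phi_T: "x \<in> T \<Longrightarrow> evalK {} (phi x) = 0"
  unfolding T_def
proof (induction rule: Q.span_induct_alt)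
  case base
  show ?case by (simp add: phi_zero evalK_zero)
next
  case (step c x y)
  then obtain A i where "x = z A i" "i \<notin> A" by blast
  with step.IH show ?case
    by (simp add: phi_add phi_scale phi_z evalK_add evalK_scale evalK_mult evalK_w)
qed

text \<open>
  The generators \<open>z\<^sub>A\<^sub>,\<^sub>i\<close> have images divisible by \<open>w\<^sub>i\<close>, so \<open>\<phi>(T\<^sub>n)\<close> vanishes at the origin and contains
  no nonzero constant. Hence a discrepancy by a constant is automatically zero.
\<close>

lemma T_eqI:
  assumes T: "x \<in> T" "y \<in> T" and eq: "phi x = phi y + scaleK c 1"
  shows "x = y"
proof -
  have "c = 0"
    using arg_cong[OF eq, of "evalK {}"] T
    by (simp add: evalK_phi_T evalK_add evalK_scale evalK_one)
  with eq have "phi x = phi y" by simp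
  moreover have "T \<subseteq> (Tbar :: ('a, 'b) Qalg set)"
    unfolding T_def Tbar_eq_span by (rule Q.span_mono) blast
  ultimately show ?thesis using T inj_on_phi_Tbar by (metis inj_onD subsetD)
qed

lemma projT_eq:
  assumes "t \<in> T"
  shows "projT (t + scaleQ c 1) = t"
  unfolding projT_def
proof (rule the_equality)
  show "t \<in> T \<and> (\<exists>d. t + scaleQ c 1 = t + scaleQ d 1)" using assms by blast
next
  fix s assume "s \<in> T \<and> (\<exists>d. t + scaleQ c 1 = s + scaleQ d 1)"
  then obtain d where s: "s \<in> T" "t + scaleQ c 1 = s + scaleQ d 1" by blast
  then have "s = t + scaleQ (c - d) 1" by (simp add: Q.scale_left_diff_distrib algebra_simps)
  then have "phi s = phi t + scaleK (c - d) 1" by (simp add: phi_add phi_scale phi_one)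
  then show "s = t" using s(1) assms T_eqI by blast
qed

text \<open>
  This is the part of surjectivity that makes the inverse image in the definition of \<^const>\<open>zset\<close>
  meaningful. Writing \<open>w\<^sub>i = (1 + w\<^sub>i) - 1\<close> moves \<open>i\<close> from \<open>B\<close> to \<open>A\<close>, until only products of the
  \<open>1 + w\<^sub>j\<close> remain; if \<open>i\<close> already lies in \<open>A\<close>, the product is zero.
\<close>

lemma mixed_product_in_phi_Tbar:
  "(\<Prod>i\<in>B. w i) * (\<Prod>j\<in>A. 1 + w j) \<in> phi ` (Tbar :: ('n::finite, 'k::field) Qalg set)"
proof -
  have "finite B" by simp
  then show ?thesis
  proof (induction B arbitrary: A)
    case empty
    obtain E :: "'n set \<Rightarrow> ('n, 'k) Qalg"
      where E: "\<And>A. phi (E A) = (\<Prod>j\<in>A. 1 + w j)" "Tbar = Q.span (range E)"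
      by (rule obtain_potential) (rule that)
    have "E A \<in> Tbar" by (simp add: E(2) Q.span_base)
    then show ?case using E(1)[of A] by (metis image_eqI mult_1 prod.empty)
  next
    case (insert i B)
    show ?case
    proof (cases "i \<in> A")
      case True
      have w_mult: "w i * (1 + w i) = (0 :: ('n, 'k) Kalg)"
        using w_rel[of i] by (simp add: power2_eq_square algebra_simps)
      have "(\<Prod>j\<in>A. 1 + w j) = (1 + w i) * (\<Prod>j\<in>A - {i}. 1 + w j :: ('n, 'k) Kalg)"
        using True by (intro prod.remove) simp_all
      then have "(\<Prod>i\<in>insert i B. w i) * (\<Prod>j\<in>A. 1 + w j)
          = (w i * (1 + w i)) * ((\<Prod>i\<in>B. w i) * (\<Prod>j\<in>A - {i}. 1 + w j :: ('n, 'k) Kalg))"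
        using insert.hyps by (simp only: prod.insert[OF insert.hyps] ac_simps)
      also have "\<dots> = phi 0" by (simp add: w_mult phi_zero)
      finally show ?thesis unfolding Tbar_eq_span using Q.span_zero by blast
    next
      case False
      obtain s :: "('n, 'k) Qalg" where
        s: "(\<Prod>i\<in>B. w i) * (\<Prod>j\<in>insert i A. 1 + w j) = phi s" "s \<in> Tbar"
        using insert.IH[of "insert i A"] by (rule imageE)
      obtain t :: "('n, 'k) Qalg" where
        t: "(\<Prod>i\<in>B. w i) * (\<Prod>j\<in>A. 1 + w j) = phi t" "t \<in> Tbar"
        using insert.IH[of A] by (rule imageE)
      have "(\<Prod>i\<in>insert i B. w i) * (\<Prod>j\<in>A. 1 + w j) = phi (s - t)"
        using insert.hyps False by (simp add: phi_diff s(1)[symmetric] t(1)[symmetric] algebra_simps)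
      moreover have "s - t \<in> Tbar"
        using s(2) t(2) unfolding Tbar_eq_span by (rule Q.span_diff)
      ultimately show ?thesis by (rule image_eqI)
    qed
  qed
qed

text \<open>
  Together with \<open>T_eqI\<close> this determines \<^const>\<open>zset\<close>; the constant, which is what the projection along
  \<open>k\<cdot>1\<close> removes, need never be computed.
\<close>

lemma zset_characterization:
  shows zset_in_T: "(zset A B :: ('n::finite, 'k::field) Qalg) \<in> T"
    and phi_zset: "\<exists>c. phi (zset A B :: ('n, 'k) Qalg)
      = (\<Prod>i\<in>B. w i) * (\<Prod>j\<in>A. 1 + w j) + scaleK c 1"
proof -
  let ?p = "(\<Prod>i\<in>B. w i) * (\<Prod>j\<in>A. 1 + w j) :: ('n, 'k) Kalg"
  obtain t c where t: "t \<in> T" "inv_into Tbar phi ?p = t + scaleQ c 1"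
    using inv_into_into[OF mixed_product_in_phi_Tbar[of B A]] unfolding Tbar_def by blast
  have "phi (t + scaleQ c 1) = ?p"
    using f_inv_into_f[OF mixed_product_in_phi_Tbar[of B A]] t(2) by metis
  then have "phi t = ?p + scaleK (- c) 1"
    by (simp add: phi_add phi_scale phi_one algebra_simps)
  moreover have "zset A B = t" by (simp add: zset_def t projT_eq)
  ultimately show "(zset A B :: ('n, 'k) Qalg) \<in> T"
    and "\<exists>c. phi (zset A B :: ('n, 'k) Qalg) = ?p + scaleK c 1"
    using t(1) by (metis, metis)
qed

section \<open>Differences of \<open>r\<close>, sums of \<open>u\<close>, and the relations\<close>

lemma r_insert_diff:
  assumes "i \<notin> A"
  shows "r (insert i A) - r A = (z A i :: ('n::finite, 'k::field) Qalg)"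
proof -
  have "\<exists>c. phi (r B :: ('n, 'k) Qalg) = (\<Prod>j\<in>B. 1 + w j) + scaleK c 1" for B
    using phi_zset[of B "{}"] by (simp add: r_def)
  from this[of "insert i A"] this[of A] obtain c d where
    c: "phi (r (insert i A) :: ('n, 'k) Qalg) = (\<Prod>j\<in>insert i A. 1 + w j) + scaleK c 1" and
    d: "phi (r A :: ('n, 'k) Qalg) = (\<Prod>j\<in>A. 1 + w j) + scaleK d 1"
    by (elim exE)
  have "phi (r (insert i A) - r A) = phi (z A i) + scaleK (c - d) (1 :: ('n, 'k) Kalg)"
    using assms by (simp add: phi_diff c d phi_z phi_free.scale_left_diff_distrib algebra_simps)
  then show ?thesis
    by (rule T_eqI[rotated 2])
       (use assms in \<open>auto simp: r_def intro!: Q.subspace_diff subspace_T z_in_T zset_in_T\<close>)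
qed

text \<open>
  Both sides map to \<open>w\<^sub>i w\<^sub>j \<Prod>\<^sub>A (1 + w)\<close> up to a constant: the left one by expanding the product over \<open>A\<close>,
  the right one because \<open>w\<^sub>j (1 + w\<^sub>i) - w\<^sub>j = w\<^sub>i w\<^sub>j\<close>.
\<close>

lemma sum_u_between:
  assumes "i \<notin> A" "j \<notin> A" "i \<noteq> j"
  shows "(\<Sum>D \<in> {D. {i, j} \<subseteq> D \<and> D \<subseteq> A \<union> {i, j}}. u D)
    = z (insert i A) j - (z A j :: ('n::finite, 'k::field) Qalg)"
proof -
  let ?X = "{D. {i, j} \<subseteq> D \<and> D \<subseteq> A \<union> {i, j}}"
  have "\<exists>c. phi (u D :: ('n, 'k) Qalg) = (\<Prod>i\<in>D. w i) + scaleK c 1" for D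
    using phi_zset[of "{}" D] by (simp add: u_def)
  then obtain c where c: "\<And>D. phi (u D :: ('n, 'k) Qalg) = (\<Prod>i\<in>D. w i) + scaleK (c D) 1"
    by metis
  have X: "?X = (\<lambda>B. insert i (insert j B)) ` Pow A"
  proof (intro equalityI subsetI)
    fix D assume "D \<in> ?X"
    then show "D \<in> (\<lambda>B. insert i (insert j B)) ` Pow A"
      by (intro image_eqI[of _ _ "D - {i, j}"]) auto
  qed auto
  have inj: "inj_on (\<lambda>B. insert i (insert j B)) (Pow A)"
    using assms by (intro inj_on_inverseI[of _ "\<lambda>D. D - {i, j}"]) auto
  have "(\<Sum>D\<in>?X. \<Prod>l\<in>D. w l) = (\<Sum>B\<in>Pow A. \<Prod>l\<in>insert i (insert j B). w l :: ('n, 'k) Kalg)"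
    unfolding X by (subst sum.reindex[OF inj]) simp
  also have "\<dots> = (\<Sum>B\<in>Pow A. w i * w j * (\<Prod>l\<in>B. w l))"
  proof (rule sum.cong[OF refl])
    fix B assume "B \<in> Pow A"
    then have "i \<notin> B" "j \<notin> B" using assms by auto
    then show "(\<Prod>l\<in>insert i (insert j B). w l) = w i * w j * (\<Prod>l\<in>B. w l :: ('n, 'k) Kalg)"
      using assms by (simp add: mult.assoc)
  qed
  also have "\<dots> = w i * w j * (\<Prod>l\<in>A. w l + 1)"
    by (simp add: prod_add sum_distrib_left)
  also have "\<dots> = w i * w j * (\<Prod>l\<in>A. 1 + w l)"
    by (simp add: add.commute)
  finally have "phi (\<Sum>D\<in>?X. u D) = w i * w j * (\<Prod>l\<in>A. 1 + w l) + scaleK (\<Sum>D\<in>?X. c D) (1 :: ('n, 'k) Kalg)"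
    by (simp add: phi_sum c sum.distrib phi_free.scale_sum_left)
  also have "\<dots> = phi (z (insert i A) j - z A j) + scaleK (\<Sum>D\<in>?X. c D) 1"
    using assms by (simp add: phi_diff phi_z algebra_simps)
  finally show ?thesis
    by (rule T_eqI[rotated 2])
       (use assms in \<open>auto simp: u_def
          intro!: Q.subspace_sum Q.subspace_diff subspace_T z_in_T zset_in_T\<close>)
qed

text \<open>
  The multiplicative relation makes \<open>z\<^sub>A\<^sub>,\<^sub>j\<close> a right factor of the left-hand side, and the additive
  relation identifies the remaining left factor.
\<close>

lemma z_diff_intertwine:
  assumes "i \<notin> A" "j \<notin> A" "i \<noteq> j"
  shows "z (insert i A) j * (z A i - z A j) = (z A i - z A j) * (z A j :: ('n::finite, 'k::field) Qalg)"
proof -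
  have "z (insert i A) j * (z A i - z A j) = (z (insert j A) i - z (insert i A) j) * z A j"
    using z_rel_mult[OF assms] by (simp add: algebra_simps)
  also have "z (insert j A) i - z (insert i A) j = z A i - (z A j :: ('n, 'k) Qalg)"
    using z_rel_add[OF assms, where 'b = 'k, symmetric]
    by (simp only: Un_insert_right Un_empty_right diff_eq_eq add_diff_eq eq_diff_eq add.commute)
  finally show ?thesis .
qed

theorem proposition1p3p1:
  fixes A :: "'n::finite set" and i j :: 'n
  assumes "i \<notin> A" and "j \<notin> A" and "i \<noteq> j"
  shows "(r (A \<union> {i, j}) - r (A \<union> {i})) * (r (A \<union> {i}) - r (A \<union> {j}))
           = (r (A \<union> {i}) - r (A \<union> {j})) * (r (A \<union> {j}) - r A :: ('n, 'k::field) Qalg)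
       \<and> commutator (z A i) (z A j)
           = (\<Sum>D \<in> {D. {i, j} \<subseteq> D \<and> D \<subseteq> A \<union> {i, j}}. u D * (z A i - z A j) :: ('n, 'k) Qalg)"
proof
  have "r (A \<union> {i, j}) - r (A \<union> {i}) = (z (insert i A) j :: ('n, 'k) Qalg)"
    using r_insert_diff[of j "insert i A"] assms by (simp add: insert_commute)
  moreover have rj: "r (A \<union> {j}) - r A = (z A j :: ('n, 'k) Qalg)"
    using r_insert_diff[of j A] assms by simp
  moreover have "r (A \<union> {i}) - r (A \<union> {j}) = (z A i - z A j :: ('n, 'k) Qalg)"
    using rj r_insert_diff[of i A] assms by (simp add: algebra_simps)
  ultimately show "(r (A \<union> {i, j}) - r (A \<union> {i})) * (r (A \<union> {i}) - r (A \<union> {j}))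
      = (r (A \<union> {i}) - r (A \<union> {j})) * (r (A \<union> {j}) - r A :: ('n, 'k) Qalg)"
    using z_diff_intertwine[OF assms] by simp
  have "(\<Sum>D \<in> {D. {i, j} \<subseteq> D \<and> D \<subseteq> A \<union> {i, j}}. u D * (z A i - z A j) :: ('n, 'k) Qalg)
      = (z (insert i A) j - z A j) * (z A i - z A j)"
    by (simp only: sum_u_between[OF assms] flip: sum_distrib_right)
  also have "\<dots> = (z A i - z A j) * z A j - z A j * (z A i - z A j)"
    by (simp only: left_diff_distrib z_diff_intertwine[OF assms])
  also have "\<dots> = commutator (z A i) (z A j)"
    by (simp add: commutator_def algebra_simps)
  finally show "commutator (z A i) (z A j)
      = (\<Sum>D \<in> {D. {i, j} \<subseteq> D \<and> D \<subseteq> A \<union> {i, j}}. u D * (z A i - z A j) :: ('n, 'k) Qalg)" ..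
qed

end
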